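(* Let $0<q<1$ and let $a,b,c$ be real numbers with $a,b<1$. Put $$T_1(a,b)=\min\left\{ab,\ ab+\frac{aq+bq-q-2ab+ab/q}{2(1-q)},\ ab+\frac{aq+bq-q-2ab+ab/q}{1-q}+\frac{a+b-q-ab/q}{1-q}\right\}.$$ If $c$ satisfies either $$c\le T_1(a,b),$$ or $c=ab$ with $$ab\ge\frac{aq+bq-q}{2-1/q},\qquad aq+bq+a+b-2q\le 2ab\qquad\text{and}\qquad \frac{\Gamma_q(\log_q(ab))}{\Gamma_q(\log_q a)\,\Gamma_q(\log_q b)}\le 2,$$ then $z\Phi[a,b;c;q,z]\in\mathcal{K}_q$ with the starlike function $g(z)=z/(1-z)$.
   Context: $\mathbb{D}=\{z\in\mathbb{C}:|z|<1\}$. The $q$-shifted factorial is $(a;q)_0=1$, $(a;q)_n=(1-a)(1-aq)\cdots(1-aq^{n-1})$ for $n\ge1$, and Heine's basic hypergeometric function is $$\Phi[a,b;c;q,z]=\sum_{n=0}^\infty\frac{(a;q)_n(b;q)_n}{(c;q)_n(q;q)_n}z^n,\qquad z\in\mathbb{D}$$ (parameters being such that it is defined). $\mathcal{A}$ is the class of analytic functions $f$ on $\mathbb{D}$ with $f(0)=0=f'(0)-1$. A function $f\in\mathcal{A}$ is starlike ($f\in\mathcal{S}^*$) if $\mathrm{Re}\,(zf'(z)/f(z))>0$ for $z\in\mathbb{D}$. The $q$-difference operator is $$(D_qf)(z)=\frac{f(z)-f(qz)}{z(1-q)}\ (z\ne0),\qquad (D_qf)(0)=f'(0).$$ A function $f\in\mathcal{A}$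 belongs to $\mathcal{K}_q$ ($q$-close-to-convex) if there exists $g\in\mathcal{S}^*$ such that $$\left|\frac{z}{g(z)}(D_qf)(z)-\frac1{1-q}\right|\le\frac1{1-q},\qquad z\in\mathbb{D};$$ "$f\in\mathcal{K}_q$ with the starlike function $g$" means that this inequality holds for that particular $g$. The $q$-gamma function is $\Gamma_q(x)=(1-q)^{1-x}\prod_{k=0}^\infty\frac{1-q^{k+1}}{1-q^{k+x}}$, and $\log_q$ is the logarithm to base $q$; the expressions $\log_q a,\log_q b,\log_q(ab)$ presuppose $a,b>0$. *)

theory Defs
  imports "HOL-Analysis.Analysis"
begin

section \<open>Basic hypergeometric functions and the q-gamma function\<close>

definition q_shifted_factorial :: "'a::comm_ring_1 \<Rightarrow> 'a \<Rightarrow> nat \<Rightarrow> 'a" where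
  "q_shifted_factorial a q n = (\<Prod>k<n. 1 - a * q ^ k)"

definition heine_phi :: "complex \<Rightarrow> complex \<Rightarrow> complex \<Rightarrow> complex \<Rightarrow> complex \<Rightarrow> complex" where
  "heine_phi a b c q z =
     (\<Sum>n. q_shifted_factorial a q n * q_shifted_factorial b q n /
           (q_shifted_factorial c q n * q_shifted_factorial q q n) * z ^ n)"

definition q_gamma :: "real \<Rightarrow> real \<Rightarrow> real" where
  "q_gamma q x =
     (1 - q) powr (1 - x) * (\<Prod>k. (1 - q ^ (k + 1)) / (1 - q powr (real k + x)))"

section \<open>Starlike and q-close-to-convex functions\<close>

definition normalized_analytic :: "(complex \<Rightarrow> complex) set" where
  "normalized_analytic = {f. f analytic_on ball 0 1 \<and> f 0 = 0 \<and> deriv f 0 = 1}"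

text \<open>
  For a normalized analytic \<open>f\<close>, both \<open>z f'(z) / f(z)\<close> and \<open>z / f(z)\<close> have a
  removable singularity at the origin, with value 1 there. As \<open>0 / 0 = 0\<close>
  in HOL, this value is given explicitly. At a zero \<open>z \<noteq> 0\<close> of \<open>f\<close>, division by zero
  yields 0, whose real part is not positive, so a starlike function has no zero
  in the unit disc other than the origin.
\<close>

definition starlike_functions :: "(complex \<Rightarrow> complex) set" where
  "starlike_functions =
     {f \<in> normalized_analytic.
        \<forall>z\<in>ball 0 1. Re (if z = 0 then 1 else z * deriv f z / f z) > 0}"

definition q_difference :: "real \<Rightarrow> (complex \<Rightarrow> complex) \<Rightarrow> complex \<Rightarrow> complex" where
  "q_difference q f z =
     (if z = 0 then deriv f 0
      else (f z - f (of_real q * z)) / (z * (1 - of_real q)))"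

definition q_close_to_convex_with ::
    "real \<Rightarrow> (complex \<Rightarrow> complex) \<Rightarrow> (complex \<Rightarrow> complex) \<Rightarrow> bool" where
  "q_close_to_convex_with q g f \<longleftrightarrow>
     f \<in> normalized_analytic \<and> g \<in> starlike_functions \<and>
     (\<forall>z\<in>ball 0 1.
        norm ((if z = 0 then 1 else z / g z) * q_difference q f z - of_real (1 / (1 - q)))
          \<le> 1 / (1 - q))"

definition q_close_to_convex_functions :: "real \<Rightarrow> (complex \<Rightarrow> complex) set" where
  "q_close_to_convex_functions q = {f. \<exists>g. q_close_to_convex_with q g f}"

section \<open>The parameter bound\<close>

definition T1 :: "real \<Rightarrow> real \<Rightarrow> real \<Rightarrow> real" where
  "T1 q a b = Min
     {a * b,
      a * b + (a * q + b * q - q - 2 * a * b + a * b / q) / (2 * (1 - q)),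
      a * b + (a * q + b * q - q - 2 * a * b + a * b / q) / (1 - q)
            + (a + b - q - a * b / q) / (1 - q)}"

end

theory Submission
  imports Defs
begin

text \<open>
  Write \<open>\<Phi>[a,b;c;q,z] = (\<Sum>n. A n * z ^ n)\<close> and \<open>B n = (1 - q ^ Suc n) * A n\<close>, so that
  \<open>B 0 = 1 - q\<close>. Since \<open>z / g z = 1 - z\<close> for \<open>g z = z / (1 - z)\<close>, and since \<open>(1 - q)\<close> times the
  \<open>q\<close>-difference quotient of \<open>z * \<Phi>\<close> is \<open>(\<Sum>n. B n * z ^ n)\<close>, the defining inequality says that
  \<open>(1 - z) * (\<Sum>n. B n * z ^ n)\<close> lies within distance \<open>1\<close> of \<open>1\<close>. Summation by parts turns this
  product into \<open>B 0 + (\<Sum>n. (B (n+1) - B n) * z ^ (n+1))\<close>, whose distance from \<open>B 0\<close> is at most the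
  total variation of \<open>B\<close>. For a monotone sequence with limit \<open>L\<close> this variation is
  \<open>\<bar>L - (1 - q)\<bar>\<close>; as \<open>B 0\<close> is at distance \<open>q\<close> from \<open>1\<close>, the inequality follows as soon as
  \<open>0 \<le> L \<le> 2 * (1 - q)\<close> (lemma \<open>q_close_to_convex_with_half_plane\<close>).

  It remains to see that \<open>B\<close> is monotone with such a limit. The difference \<open>B (n+1) - B n\<close> is a
  negative multiple of a quadratic polynomial in \<open>x = q ^ n\<close>, so the sign of that polynomial on
  \<open>[0, 1]\<close> decides everything (lemma \<open>heine_coeff_diff\<close>).

  If \<open>c\<close> is at most the bound \<open>T1 q a b\<close>, the three entries of the minimum say in turn that the
  polynomial is convex, that its slope at \<open>1\<close> is nonpositive, and that its value at \<open>1\<close> is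
  nonnegative. Hence it is nonnegative on \<open>[0, 1]\<close> and \<open>B\<close> decreases from \<open>1 - q\<close> to a limit that is
  nonnegative because all \<open>B n\<close> are positive.

  If \<open>c = a * b\<close> with \<open>a\<close> and \<open>b\<close> between \<open>0\<close> and \<open>1\<close>, the polynomial is affine and the inequality
  \<open>a * q + b * q + a + b - 2 * q \<le> 2 * a * b\<close> is nonpositivity at \<open>1\<close>. By the arithmetic-geometric
  mean inequality it forces \<open>a * b \<le> q\<^sup>2\<close>, which gives nonpositivity at \<open>0\<close> as well. So \<open>B\<close>
  increases, and its limit is \<open>1 - q\<close> times the quotient of \<open>q\<close>-gamma values that is assumed to be
  at most \<open>2\<close>.
\<close>

section \<open>Shifted factorials, their limits, and the q-gamma function\<close>

lemma q_shifted_factorial_Suc: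
  "q_shifted_factorial u q (Suc n) = q_shifted_factorial u q n * (1 - u * q ^ n)"
  by (simp add: q_shifted_factorial_def)

lemma q_shifted_factorial_of_real:
  "q_shifted_factorial (of_real u) (of_real q) n =
     (of_real (q_shifted_factorial u q n) :: 'a :: {real_algebra_1, comm_ring_1})"
  by (induction n) (simp_all add: q_shifted_factorial_Suc, simp add: q_shifted_factorial_def)

lemma one_minus_mult_pos:
  fixes u x :: real
  assumes "u < 1" "0 \<le> x" "x \<le> 1"
  shows "0 < 1 - u * x"
proof (cases "u \<le> 0")
  case True
  then have "u * x \<le> 0" using assms by (simp add: mult_nonpos_nonneg)
  then show ?thesis by linarith
next
  case False
  then have "u * x \<le> u * 1" using assms by (intro mult_left_mono) auto
  then show ?thesis using assms by linarith
qed

lemma q_shifted_factorial_pos: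
  fixes u q :: real
  assumes "0 < q" "q < 1" "u < 1"
  shows "0 < q_shifted_factorial u q n"
  unfolding q_shifted_factorial_def
  using assms by (intro prod_pos one_minus_mult_pos) (auto intro: power_le_one)

definition q_factorial_inf :: "real \<Rightarrow> real \<Rightarrow> real" where
  "q_factorial_inf u q = (\<Prod>k. 1 - u * q ^ k)"

lemma has_prod_q_factorial_inf:
  fixes u q :: real
  assumes "0 < q" "q < 1" "u < 1"
  shows "(\<lambda>k. 1 - u * q ^ k) has_prod q_factorial_inf u q"
proof -
  have "summable (\<lambda>k. norm (1 - u * q ^ k - 1))"
    using assms by (simp add: abs_mult power_abs summable_mult summable_geometric)
  then have "abs_convergent_prod (\<lambda>k. 1 - u * q ^ k)"
    by (rule summable_imp_abs_convergent_prod)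
  then have "convergent_prod (\<lambda>k. 1 - u * q ^ k)"
    by (rule abs_convergent_prod_imp_convergent_prod)
  then show ?thesis
    unfolding q_factorial_inf_def by (rule convergent_prod_has_prod)
qed

lemma q_factorial_inf_nonzero:
  fixes u q :: real
  assumes "0 < q" "q < 1" "u < 1"
  shows "q_factorial_inf u q \<noteq> 0"
proof
  assume "q_factorial_inf u q = 0"
  then have "0 \<in> range (\<lambda>k. 1 - u * q ^ k)"
    using has_prod_eq_0_iff[OF has_prod_q_factorial_inf[OF assms]] by simp
  then obtain k where "1 - u * q ^ k = 0" by force
  moreover have "0 < 1 - u * q ^ k"
    using assms by (intro one_minus_mult_pos) (auto intro: power_le_one)
  ultimately show False by simp
qed

lemma q_shifted_factorial_tendsto:
  fixes u q :: real
  assumes "0 < q" "q < 1" "u < 1"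
  shows "q_shifted_factorial u q \<longlonglongrightarrow> q_factorial_inf u q"
proof -
  have "(\<lambda>n. \<Prod>k\<le>n. 1 - u * q ^ k) \<longlonglongrightarrow> q_factorial_inf u q"
    using has_prod_imp_tendsto[OF has_prod_q_factorial_inf[OF assms]] .
  then have "(\<lambda>n. q_shifted_factorial u q (Suc n)) \<longlonglongrightarrow> q_factorial_inf u q"
    by (simp add: q_shifted_factorial_def lessThan_Suc_atMost)
  then show ?thesis by (rule LIMSEQ_imp_Suc)
qed

text \<open>
  With \<open>x = log q u\<close> the denominators \<open>1 - q powr (k + x)\<close> are \<open>1 - u * q ^ k\<close>, so the product in
  \<open>\<Gamma>\<^sub>q(x)\<close> is \<open>(q; q)\<^sub>\<infinity> / (u; q)\<^sub>\<infinity>\<close>.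
\<close>
lemma q_gamma_log:
  fixes u q :: real
  assumes "0 < q" "q < 1" "0 < u" "u < 1"
  shows "q_gamma q (log q u) =
    (1 - q) powr (1 - log q u) * (q_factorial_inf q q / q_factorial_inf u q)"
proof -
  have "q powr (real k + log q u) = u * q ^ k" for k
    using assms by (simp add: powr_add powr_realpow)
  moreover have "(\<lambda>k. (1 - q * q ^ k) / (1 - u * q ^ k)) has_prod
      (q_factorial_inf q q / q_factorial_inf u q)"
    using assms by (intro has_prod_divide has_prod_q_factorial_inf) auto
  ultimately have "(\<lambda>k. (1 - q ^ (k + 1)) / (1 - q powr (real k + log q u))) has_prod
      (q_factorial_inf q q / q_factorial_inf u q)"
    by simp
  then show ?thesis
    unfolding q_gamma_def by (simp only: has_prod_unique[symmetric])
qed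

text \<open>
  Because \<open>log q (a * b) = log q a + log q b\<close>, the powers of \<open>1 - q\<close> cancel up to a single factor.
  The remaining product is the limit of the coefficients of \<open>\<Phi>[a,b;a*b;q,z]\<close>.
\<close>
lemma q_gamma_quotient:
  fixes a b q :: real
  assumes "0 < q" "q < 1" "0 < a" "a < 1" "0 < b" "b < 1"
  shows "q_gamma q (log q (a * b)) / (q_gamma q (log q a) * q_gamma q (log q b)) =
    q_factorial_inf a q * q_factorial_inf b q /
      (q_factorial_inf (a * b) q * q_factorial_inf q q) / (1 - q)"
proof -
  have ab: "0 < a * b" "a * b < 1"
    using assms mult_strict_mono[of a 1 b 1] by auto
  define x y where "x = log q a" and "y = log q b"
  have "log q (a * b) = x + y"
    using assms by (simp add: x_def y_def log_mult)
  moreover have "(1 - q) powr (1 - (x + y)) = (1 - q) powr (1 - x) * (1 - q) powr (1 - y) / (1 - q)"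
  proof -
    have "1 - (x + y) = (1 - x) + (1 - y) - 1" by simp
    then show ?thesis using assms by (simp only: powr_diff powr_add) simp
  qed
  ultimately have G: "q_gamma q (log q (a * b)) = (1 - q) powr (1 - x) * (1 - q) powr (1 - y) / (1 - q)
       * (q_factorial_inf q q / q_factorial_inf (a * b) q)"
    using q_gamma_log[OF assms(1,2) ab] by simp
  have nz: "q_factorial_inf q q \<noteq> 0" "q_factorial_inf a q \<noteq> 0" "q_factorial_inf b q \<noteq> 0"
     "q_factorial_inf (a * b) q \<noteq> 0" "(1 - q) powr (1 - x) \<noteq> 0" "(1 - q) powr (1 - y) \<noteq> 0"
    using assms ab by (auto simp: q_factorial_inf_nonzero)
  have Gab: "q_gamma q (log q a) = (1 - q) powr (1 - x) * (q_factorial_inf q q / q_factorial_inf a q)"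
    "q_gamma q (log q b) = (1 - q) powr (1 - y) * (q_factorial_inf q q / q_factorial_inf b q)"
    unfolding x_def y_def using assms by (simp_all only: q_gamma_log)
  show ?thesis
    unfolding G Gab
    using nz assms by (simp add: field_simps)
qed

section \<open>Power series with monotone coefficients\<close>

lemma monoseq_sums_abs_diff:
  fixes B :: "nat \<Rightarrow> real"
  assumes "monoseq B" "B \<longlonglongrightarrow> L"
  shows "(\<lambda>n. \<bar>B (Suc n) - B n\<bar>) sums \<bar>L - B 0\<bar>"
proof -
  have T: "(\<lambda>n. B (Suc n) - B n) sums (L - B 0)"
    by (rule telescope_sums[OF assms(2)])
  consider "incseq B" | "decseq B" using assms(1) monoseq_iff by auto
  then show ?thesis
  proof cases
    case 1
    then have "B 0 \<le> L" "\<And>n. B n \<le> B (Suc n)"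
      using assms(2) by (auto intro: incseq_le incseq_SucD)
    then show ?thesis using T by simp
  next
    case 2
    then have "L \<le> B 0" "\<And>n. B (Suc n) \<le> B n"
      using assms(2) by (auto intro: decseq_ge decseq_SucD)
    then show ?thesis using sums_minus[OF T] by (simp add: abs_of_nonpos)
  qed
qed

lemma summable_Bseq_power_series:
  fixes C :: "nat \<Rightarrow> complex"
  assumes "Bseq C" "norm z < 1"
  shows "summable (\<lambda>n. C n * z ^ n)"
proof -
  obtain K where K: "\<And>n. norm (C n) \<le> K" using assms(1) by (auto simp: Bseq_def)
  show ?thesis
  proof (rule summable_comparison_test')
    show "summable (\<lambda>n. K * norm z ^ n)"
      using assms(2) by (intro summable_mult summable_geometric) auto
    show "norm (C n * z ^ n) \<le> K * norm z ^ n" if "n \<ge> 0" for n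
      unfolding norm_mult norm_power using K by (intro mult_right_mono) auto
  qed
qed

text \<open>
  Multiplication by \<open>1 - z\<close> replaces the coefficients by their differences, so inside the unit disc
  the series differs from its constant term by at most the total variation of the coefficients.
\<close>
lemma norm_one_minus_mult_power_series_le:
  fixes B :: "nat \<Rightarrow> real" and z :: complex
  assumes "monoseq B" "B \<longlonglongrightarrow> L" "norm z < 1"
  shows "norm ((1 - z) * (\<Sum>n. of_real (B n) * z ^ n) - of_real (B 0)) \<le> \<bar>L - B 0\<bar>"
proof -
  let ?S = "\<Sum>n. of_real (B n) * z ^ n"
  have "Bseq B" using assms(2) by (intro convergent_imp_Bseq convergentI)
  then have "Bseq (\<lambda>n. complex_of_real (B n))" by (simp add: Bseq_def)
  then have s: "(\<lambda>n. of_real (B n) * z ^ n) sums ?S"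
    using assms(3) by (intro summable_sums summable_Bseq_power_series)
  have 1: "(\<lambda>n. of_real (B (Suc n)) * z ^ Suc n) sums (?S - of_real (B 0))"
    using s by (subst sums_Suc_iff) simp
  have 2: "(\<lambda>n. z * (of_real (B n) * z ^ n)) sums (z * ?S)"
    by (rule sums_mult[OF s])
  have E: "(\<lambda>n. of_real (B (Suc n) - B n) * z ^ Suc n) sums ((1 - z) * ?S - of_real (B 0))"
    using sums_diff[OF 1 2] by (simp add: algebra_simps)
  have V: "(\<lambda>n. \<bar>B (Suc n) - B n\<bar>) sums \<bar>L - B 0\<bar>"
    by (rule monoseq_sums_abs_diff[OF assms(1,2)])
  have le: "norm (of_real (B (Suc n) - B n) * z ^ Suc n) \<le> \<bar>B (Suc n) - B n\<bar>" for n
  proof -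
    have "norm (z ^ Suc n) \<le> 1"
      unfolding norm_power using assms(3) by (intro power_le_one) auto
    then show ?thesis
      unfolding norm_mult norm_of_real by (intro mult_left_le) auto
  qed
  show ?thesis
    using norm_suminf_le[OF le sums_summable[OF V]] sums_unique[OF E] sums_unique[OF V]
    by simp
qed

section \<open>Closeness to the half-plane map\<close>

text \<open>
  Here \<open>z * g' z / g z = 1 / (1 - z)\<close>, and \<open>1 - z\<close> has positive real part in the unit disc.
\<close>
lemma half_plane_map_starlike: "(\<lambda>z. z / (1 - z)) \<in> starlike_functions"
proof -
  have D: "((\<lambda>z. z / (1 - z)) has_field_derivative 1 / (1 - z) ^ 2) (at z)"
    if "norm z < 1" for z :: complex
    using that by (auto intro!: derivative_eq_intros simp: field_simps power2_eq_square)
  have "(\<lambda>z::complex. z / (1 - z)) holomorphic_on ball 0 1"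
    unfolding holomorphic_on_open[OF open_ball] by (intro ballI exI, rule D) simp
  moreover have "Re (z * deriv (\<lambda>z. z / (1 - z)) z / (z / (1 - z))) > 0"
    if "norm z < 1" "z \<noteq> 0" for z :: complex
  proof -
    have ne: "1 - z \<noteq> 0" using that by auto
    have "z * deriv (\<lambda>z. z / (1 - z)) z / (z / (1 - z)) = 1 / (1 - z)"
    proof -
      have "z * (1 / w\<^sup>2) / (z / w) = 1 / w" if "w \<noteq> 0" for w
        using that \<open>z \<noteq> 0\<close> by (simp add: power2_eq_square)
      then show ?thesis using DERIV_imp_deriv[OF D[OF that(1)]] ne by simp
    qed
    moreover have "Re z < 1" using that complex_Re_le_cmod[of z] by linarith
    then have "Re (1 / (1 - z)) > 0" using ne
      by (simp add: Re_divide sum_power2_gt_zero_iff complex_eq_iff)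
    ultimately show ?thesis by simp
  qed
  ultimately show ?thesis
    using DERIV_imp_deriv[OF D[of 0]]
    by (simp add: starlike_functions_def normalized_analytic_def analytic_on_open)
qed

text \<open>
  After multiplication by \<open>1 - q\<close>, the inequality to be shown concerns the disc of radius \<open>1\<close> about
  \<open>1\<close>. The constant term \<open>1 - q\<close> lies at distance \<open>q\<close> from the centre, which leaves room for a total
  variation of \<open>1 - q\<close>; the bounds on \<open>L\<close> say that \<open>\<bar>L - (1 - q)\<bar> \<le> 1 - q\<close>.
\<close>
lemma q_close_to_convex_with_half_plane:
  fixes A :: "nat \<Rightarrow> real" and q :: real
  assumes q: "0 < q" "q < 1" and A0: "A 0 = 1"
    and mono: "monoseq (\<lambda>n. (1 - q ^ Suc n) * A n)"
    and lim: "(\<lambda>n. (1 - q ^ Suc n) * A n) \<longlonglongrightarrow> L"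
    and L: "0 \<le> L" "L \<le> 2 * (1 - q)"
  shows "q_close_to_convex_with q (\<lambda>z. z / (1 - z))
    (\<lambda>z. z * (\<Sum>n. of_real (A n) * z ^ n))"
proof -
  define B where "B n = (1 - q ^ Suc n) * A n" for n
  define \<Phi> where "\<Phi> z = (\<Sum>n. complex_of_real (A n) * z ^ n)" for z
  have B0: "B 0 = 1 - q" by (simp add: B_def A0)
  \<comment> \<open>As the weights are at least \<open>1 - q\<close>, boundedness of \<open>B\<close> passes to \<open>A\<close>, and the series converges
    in the whole disc.\<close>
  have "Bseq B" using lim unfolding B_def by (intro convergent_imp_Bseq convergentI)
  then obtain K where K: "\<And>n. \<bar>B n\<bar> \<le> K" by (auto simp: Bseq_def)
  have "\<bar>A n\<bar> \<le> K / (1 - q)" for n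
  proof -
    have "q * q ^ n \<le> q * 1" using q by (intro mult_left_mono power_le_one) auto
    then have "(1 - q) * \<bar>A n\<bar> \<le> \<bar>B n\<bar>"
      unfolding B_def abs_mult by (intro mult_right_mono) (auto simp: abs_if)
    then show ?thesis using K[of n] q by (simp add: field_simps)
  qed
  then have "Bseq (\<lambda>n. complex_of_real (A n))"
    by (intro BseqI'[where K = "K / (1 - q)"]) simp
  then have sm: "summable (\<lambda>n. complex_of_real (A n) * z ^ n)" if "norm z < 1" for z
    using that by (rule summable_Bseq_power_series)
  define \<Phi>' where "\<Phi>' z = (\<Sum>n. diffs (\<lambda>n. complex_of_real (A n)) n * z ^ n)" for z
  have D: "(\<Phi> has_field_derivative \<Phi>' z) (at z)" if "norm z < 1" for z
    using termdiffs_strong'[OF sm that] unfolding \<Phi>_def[abs_def] \<Phi>'_def .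
  have fD: "((\<lambda>z. z * \<Phi> z) has_field_derivative \<Phi> z + z * \<Phi>' z) (at z)" if "norm z < 1" for z
    using DERIV_mult[OF DERIV_ident D[OF that]] by (simp add: algebra_simps)
  have \<Phi>0: "\<Phi> 0 = 1" unfolding \<Phi>_def by (simp add: A0 powser_zero)
  have deriv0: "deriv (\<lambda>z. z * \<Phi> z) 0 = 1"
    using DERIV_imp_deriv[OF fD[of 0]] \<Phi>0 by simp
  have "(\<lambda>z. z * \<Phi> z) holomorphic_on ball 0 1"
    unfolding holomorphic_on_open[OF open_ball] by (intro ballI exI, rule fD) simp
  then have norm_an: "(\<lambda>z. z * \<Phi> z) \<in> normalized_analytic"
    using deriv0 by (simp add: normalized_analytic_def analytic_on_open)
  have qdiff: "q_difference q (\<lambda>z. z * \<Phi> z) z = (\<Sum>n. of_real (B n) * z ^ n) / of_real (1 - q)"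
    if z: "norm z < 1" for z
  proof (cases "z = 0")
    case True
    then show ?thesis using deriv0 q
      by (simp add: q_difference_def powser_zero B0)
  next
    case False
    have "norm (of_real q * z) < 1"
      using z q mult_strict_mono[of q 1 "norm z" 1] by (simp add: norm_mult)
    then have "(\<lambda>n. of_real (A n) * z ^ n - of_real q * (of_real (A n) * (of_real q * z) ^ n))
        sums (\<Phi> z - of_real q * \<Phi> (of_real q * z))"
      unfolding \<Phi>_def using sm z by (intro sums_diff sums_mult summable_sums) auto
    then have "(\<lambda>n. of_real (B n) * z ^ n) sums (\<Phi> z - of_real q * \<Phi> (of_real q * z))"
      by (simp add: B_def algebra_simps power_mult_distrib)
    then have "(\<Sum>n. of_real (B n) * z ^ n) = \<Phi> z - of_real q * \<Phi> (of_real q * z)"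
      by (simp add: sums_iff)
    moreover have "z * \<Phi> z - of_real q * z * \<Phi> (of_real q * z) =
        z * (\<Phi> z - of_real q * \<Phi> (of_real q * z))"
      by (simp add: algebra_simps)
    ultimately show ?thesis using False
      by (simp add: q_difference_def)
  qed
  have "norm ((if z = 0 then 1 else z / (z / (1 - z))) * q_difference q (\<lambda>z. z * \<Phi> z) z
      - of_real (1 / (1 - q))) \<le> 1 / (1 - q)" if z: "norm z < 1" for z
  proof -
    define S where "S = (\<Sum>n. complex_of_real (B n) * z ^ n)"
    have "norm ((1 - z) * S - of_real (1 - q)) \<le> \<bar>L - (1 - q)\<bar>"
      unfolding S_def B0[symmetric]
      by (rule norm_one_minus_mult_power_series_le) (use mono lim z B_def in auto)
    also have "\<bar>L - (1 - q)\<bar> \<le> 1 - q" using L by (simp add: abs_le_iff)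
    finally have "norm ((1 - z) * S - of_real (1 - q)) \<le> 1 - q" .
    moreover have "norm (((1 - z) * S - of_real (1 - q)) - of_real q)
        \<le> norm ((1 - z) * S - of_real (1 - q)) + norm (complex_of_real q)"
      by (rule norm_triangle_ineq4)
    ultimately have le: "norm ((1 - z) * S - 1) \<le> 1" using q by simp
    have w: "(if z = 0 then 1 else z / (z / (1 - z))) = 1 - z" using z by auto
    have "(1 - z) * (S / of_real (1 - q)) - of_real (1 / (1 - q)) =
        ((1 - z) * S - 1) / of_real (1 - q)"
      by (simp add: diff_divide_distrib)
    then have "norm ((1 - z) * (S / of_real (1 - q)) - of_real (1 / (1 - q))) =
        norm ((1 - z) * S - 1) / (1 - q)"
      using q by (simp add: norm_divide del: of_real_diff)
    then show ?thesis
      using le q unfolding w qdiff[OF z] S_def[symmetric] by (simp add: divide_right_mono)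
  qed
  then show ?thesis
    using norm_an half_plane_map_starlike
    by (auto simp: q_close_to_convex_with_def \<Phi>_def[symmetric])
qed

section \<open>Monotonicity of the weighted Heine coefficients\<close>

definition heine_coeff :: "real \<Rightarrow> real \<Rightarrow> real \<Rightarrow> real \<Rightarrow> nat \<Rightarrow> real" where
  "heine_coeff a b c q n =
     q_shifted_factorial a q n * q_shifted_factorial b q n /
       (q_shifted_factorial c q n * q_shifted_factorial q q n)"

lemma heine_phi_of_real:
  "heine_phi (of_real a) (of_real b) (of_real c) (of_real q) z =
     (\<Sum>n. of_real (heine_coeff a b c q n) * z ^ n)"
  by (simp add: heine_phi_def heine_coeff_def q_shifted_factorial_of_real)

lemma heine_coeff_pos:
  assumes "0 < q" "q < 1" "a < 1" "b < 1" "c < 1"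
  shows "0 < heine_coeff a b c q n"
  using assms by (simp add: heine_coeff_def q_shifted_factorial_pos)

text \<open>
  The quadratic polynomial \<open>((1 - c x) (1 - q x)\<^sup>2 - (1 - q\<^sup>2 x) (1 - a x) (1 - b x)) / x\<close>.
\<close>
definition heine_decrement :: "real \<Rightarrow> real \<Rightarrow> real \<Rightarrow> real \<Rightarrow> real \<Rightarrow> real" where
  "heine_decrement a b c q x =
     (a + b - c - 2 * q + q\<^sup>2) + (q\<^sup>2 + 2 * c * q - a * b - (a + b) * q\<^sup>2) * x + q\<^sup>2 * (a * b - c) * x\<^sup>2"

text \<open>
  The quotient of consecutive weighted coefficients is
  \<open>(1 - q\<^sup>2 x) (1 - a x) (1 - b x) / ((1 - c x) (1 - q x)\<^sup>2)\<close> at \<open>x = q ^ n\<close>; comparing it with \<open>1\<close>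
  amounts to the sign of \<open>heine_decrement\<close>, since every other factor is positive.
\<close>
lemma heine_coeff_diff:
  assumes q: "0 < q" "q < 1" and "a < 1" "b < 1" "c < 1"
  shows "\<exists>r>0. (1 - q ^ Suc (Suc n)) * heine_coeff a b c q (Suc n)
      - (1 - q ^ Suc n) * heine_coeff a b c q n = - r * heine_decrement a b c q (q ^ n)"
proof -
  define x A where "x = q ^ n" and "A = heine_coeff a b c q n"
  have x: "0 < x" "x \<le> 1" using q by (auto simp: x_def power_le_one)
  have pos: "0 < 1 - c * x" "0 < 1 - q * x" "0 < A"
    using x assms unfolding A_def by (auto intro!: one_minus_mult_pos heine_coeff_pos simp del: diff_gt_0_iff_gt)
  have S: "heine_coeff a b c q (Suc n) = A * ((1 - a * x) * (1 - b * x)) / ((1 - c * x) * (1 - q * x))"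
    by (simp add: heine_coeff_def A_def x_def q_shifted_factorial_Suc mult_ac)
  have "(1 - q\<^sup>2 * x) * ((1 - a * x) * (1 - b * x)) - (1 - q * x) * ((1 - c * x) * (1 - q * x))
      = - (x * heine_decrement a b c q x)"
    by (simp add: heine_decrement_def algebra_simps power2_eq_square)
  then have "A * ((1 - q\<^sup>2 * x) * ((1 - a * x) * (1 - b * x)) - (1 - q * x) * ((1 - c * x) * (1 - q * x)))
       / ((1 - c * x) * (1 - q * x)) = - (A * x / ((1 - c * x) * (1 - q * x))) * heine_decrement a b c q x"
    by simp
  moreover have "A * ((1 - q\<^sup>2 * x) * ((1 - a * x) * (1 - b * x)) - (1 - q * x) * ((1 - c * x) * (1 - q * x)))
       / ((1 - c * x) * (1 - q * x)) =
     (1 - q\<^sup>2 * x) * (A * ((1 - a * x) * (1 - b * x)) / ((1 - c * x) * (1 - q * x))) - (1 - q * x) * A"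
    using pos by (simp add: divide_simps) (simp add: algebra_simps)
  ultimately have "(1 - q ^ Suc (Suc n)) * heine_coeff a b c q (Suc n)
      - (1 - q ^ Suc n) * heine_coeff a b c q n = - (A * x / ((1 - c * x) * (1 - q * x))) * heine_decrement a b c q x"
    unfolding S A_def[symmetric] by (simp add: x_def power2_eq_square mult.assoc)
  moreover have "0 < A * x / ((1 - c * x) * (1 - q * x))" using pos x by simp
  ultimately show ?thesis unfolding x_def by blast
qed

text \<open>
  The entries of the minimum, cleared of denominators. In this form they express convexity, the sign
  of the slope at \<open>1\<close> and the sign of the value at \<open>1\<close> of \<open>heine_decrement a b c q\<close>.
\<close>
lemma T1_le:
  fixes q a b c :: real
  assumes q: "0 < q" "q < 1" and T: "c \<le> T1 q a b"
  shows "c \<le> a * b"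
    and "2 * q * (1 - q) * (c - a * b) \<le> (a + b) * q\<^sup>2 - q\<^sup>2 - 2 * a * b * q + a * b"
    and "(1 + q) * ((1 - a) * (1 - b)) \<le> (1 - q) * (1 - c)"
proof -
  show "c \<le> a * b" using T by (simp add: T1_def)
  have "c - a * b \<le> (a * q + b * q - q - 2 * a * b + a * b / q) / (2 * (1 - q))"
    using T by (simp add: T1_def)
  then have "(c - a * b) * (2 * (1 - q)) \<le> a * q + b * q - q - 2 * a * b + a * b / q"
    using q by (simp add: pos_le_divide_eq)
  then have "q * ((c - a * b) * (2 * (1 - q))) \<le> q * (a * q + b * q - q - 2 * a * b + a * b / q)"
    using q by (intro mult_left_mono) auto
  also have "\<dots> = (a + b) * q\<^sup>2 - q\<^sup>2 - 2 * a * b * q + a * b"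
    using q by (simp add: algebra_simps power2_eq_square)
  finally show "2 * q * (1 - q) * (c - a * b) \<le> (a + b) * q\<^sup>2 - q\<^sup>2 - 2 * a * b * q + a * b"
    by (simp add: mult_ac)
  have "c - a * b \<le> (a * q + b * q - q - 2 * a * b + a * b / q) / (1 - q)
            + (a + b - q - a * b / q) / (1 - q)"
    using T by (simp add: T1_def)
  also have "\<dots> = (a * q + b * q + a + b - 2 * q - 2 * a * b) / (1 - q)"
    by (simp flip: add_divide_distrib)
  finally have "(c - a * b) * (1 - q) \<le> a * q + b * q + a + b - 2 * q - 2 * a * b"
    using q by (simp add: pos_le_divide_eq)
  then show "(1 + q) * ((1 - a) * (1 - b)) \<le> (1 - q) * (1 - c)"
    by (simp add: algebra_simps)
qed

text \<open>
  This makes every factor of \<open>(c; q)\<^sub>n\<close> positive. The bound \<open>c \<le> a * b\<close> would not suffice, as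
  \<open>a * b\<close> may exceed \<open>1\<close> for negative \<open>a\<close> and \<open>b\<close>.
\<close>
lemma T1_imp_less_one:
  fixes q a b c :: real
  assumes "0 < q" "q < 1" "a < 1" "b < 1" "c \<le> T1 q a b"
  shows "c < 1"
proof -
  have "0 < (1 + q) * ((1 - a) * (1 - b))" using assms by simp
  also have "\<dots> \<le> (1 - q) * (1 - c)" using T1_le(3)[OF assms(1,2,5)] .
  finally show ?thesis using assms by (simp add: zero_less_mult_iff)
qed

text \<open>
  Taylor expansion at \<open>x = 1\<close>: value and curvature are nonnegative there, and the slope is nonpositive,
  so all terms are nonnegative to the left of \<open>1\<close>.
\<close>
lemma heine_decrement_nonneg:
  fixes q a b c x :: real
  assumes q: "0 < q" "q < 1" and T: "c \<le> T1 q a b" and x: "0 \<le> x" "x \<le> 1"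
  shows "0 \<le> heine_decrement a b c q x"
proof -
  define p1 where "p1 = a + b - c - 2 * q + q\<^sup>2"
  define p2 where "p2 = q\<^sup>2 + 2 * c * q - a * b - (a + b) * q\<^sup>2"
  define p3 where "p3 = q\<^sup>2 * (a * b - c)"
  have 3: "0 \<le> p3" using T1_le(1)[OF q T] by (simp add: p3_def)
  have 2: "p2 + 2 * p3 \<le> 0"
    using T1_le(2)[OF q T] by (simp add: p2_def p3_def algebra_simps power2_eq_square)
  have E: "p1 + p2 + p3 = (1 - q) * ((1 - q) * (1 - c) - (1 + q) * ((1 - a) * (1 - b)))"
    by (simp add: p1_def p2_def p3_def algebra_simps power2_eq_square)
  have "(1 - q) * (1 - c) - (1 + q) * ((1 - a) * (1 - b)) \<ge> 0"
    using T1_le(3)[OF q T] by simp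
  then have 1: "0 \<le> p1 + p2 + p3" unfolding E using q by (intro mult_nonneg_nonneg) auto
  have "heine_decrement a b c q x = (p1 + p2 + p3) + (1 - x) * (- (p2 + 2 * p3)) + p3 * (1 - x)\<^sup>2"
    by (simp add: heine_decrement_def p1_def[symmetric] p2_def[symmetric] p3_def[symmetric])
       (simp add: algebra_simps power2_eq_square)
  moreover have "0 \<le> (1 - x) * (- (p2 + 2 * p3))" using x 2 by (intro mult_nonneg_nonneg) auto
  moreover have "0 \<le> p3 * (1 - x)\<^sup>2" using 3 by simp
  ultimately show ?thesis using 1 by linarith
qed

text \<open>
  For \<open>c = a * b\<close> the quadratic term vanishes, so the two end points suffice. The value at \<open>1\<close> is
  \<open>1 - q\<close> times the assumed inequality. By the same inequality, \<open>1 + q\<close> times the value at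
  \<open>0\<close> is at most \<open>(1 - q) * (a * b - q\<^sup>2)\<close>, whose sign comes from \<open>2 * t \<le> a + b\<close> with \<open>t = sqrt (a * b)\<close>: the
  assumption then yields \<open>(1 - t) * (t - q) \<le> 0\<close>, hence \<open>t \<le> q\<close>.
\<close>
lemma heine_decrement_nonpos:
  fixes q a b x :: real
  assumes q: "0 < q" "q < 1" and a: "0 < a" "a < 1" and b: "0 < b" "b < 1"
    and le: "a * q + b * q + a + b - 2 * q \<le> 2 * a * b" and x: "0 \<le> x" "x \<le> 1"
  shows "heine_decrement a b (a * b) q x \<le> 0"
proof -
  define t where "t = sqrt (a * b)"
  have tt: "t * t = a * b" using a b by (simp add: t_def)
  have "a * b < 1" using a b mult_strict_mono[of a 1 b 1] by simp
  then have t1: "t < 1" by (simp add: t_def)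
  have "2 * t \<le> a + b" using arith_geo_mean_sqrt[of a b] a b by (simp add: t_def)
  then have "2 * t * (1 + q) \<le> (a + b) * (1 + q)" using q by (intro mult_right_mono) auto
  then have "(1 - t) * (t - q) \<le> 0" using le tt by (simp add: algebra_simps)
  then have "t \<le> q" using t1 by (simp add: mult_le_0_iff)
  moreover have "0 \<le> t" using a b by (simp add: t_def)
  ultimately have "t * t \<le> q * q" using q by (intro mult_mono) auto
  then have abq: "a * b \<le> q\<^sup>2" by (simp add: tt power2_eq_square)
  define p1 where "p1 = heine_decrement a b (a * b) q 0"
  define e where "e = heine_decrement a b (a * b) q 1"
  have "(1 + q) * p1 = (a * q + b * q + a + b - 2 * q - 2 * a * b) + (1 - q) * (a * b - q\<^sup>2)"
    by (simp add: p1_def heine_decrement_def algebra_simps power2_eq_square)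
  moreover have "(1 - q) * (a * b - q\<^sup>2) \<le> 0" using q abq by (intro mult_nonneg_nonpos) auto
  ultimately have "(1 + q) * p1 \<le> 0" using le by linarith
  then have p1: "p1 \<le> 0" using q by (simp add: mult_le_0_iff)
  have "e = (1 - q) * (a * q + b * q + a + b - 2 * q - 2 * a * b)"
    by (simp add: e_def heine_decrement_def algebra_simps power2_eq_square)
  then have e: "e \<le> 0" using q le by (simp add: mult_nonneg_nonpos)
  have "heine_decrement a b (a * b) q x = (1 - x) * p1 + x * e"
    by (simp add: p1_def e_def heine_decrement_def algebra_simps)
  moreover have "(1 - x) * p1 \<le> 0" using x p1 by (intro mult_nonneg_nonpos) auto
  moreover have "x * e \<le> 0" using x e by (intro mult_nonneg_nonpos) auto
  ultimately show ?thesis by linarith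
qed

section \<open>Heine functions close to the half-plane map\<close>

theorem theorem3p2:
  fixes q a b c :: real
  assumes "0 < q" and "q < 1"
    and "a < 1" and "b < 1"
    and "c \<le> T1 q a b \<or>
         (c = a * b \<and> 0 < a \<and> 0 < b \<and> q \<noteq> 1 / 2 \<and>
          a * b \<ge> (a * q + b * q - q) / (2 - 1 / q) \<and>
          a * q + b * q + a + b - 2 * q \<le> 2 * a * b \<and>
          q_gamma q (log q (a * b)) / (q_gamma q (log q a) * q_gamma q (log q b)) \<le> 2)"
  shows "(\<lambda>z. z * heine_phi (of_real a) (of_real b) (of_real c) (of_real q) z)
           \<in> q_close_to_convex_functions q \<and>
         q_close_to_convex_with q (\<lambda>z. z / (1 - z))
           (\<lambda>z. z * heine_phi (of_real a) (of_real b) (of_real c) (of_real q) z)"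
proof -
  note q = assms(1,2)
  define B where "B n = (1 - q ^ Suc n) * heine_coeff a b c q n" for n
  have q_pow: "0 \<le> q ^ n" "q ^ n \<le> 1" for n using q by (auto simp: power_le_one)
  have B0: "B 0 = 1 - q" by (simp add: B_def heine_coeff_def q_shifted_factorial_def)
  have "\<exists>L. monoseq B \<and> B \<longlonglongrightarrow> L \<and> 0 \<le> L \<and> L \<le> 2 * (1 - q)"
    using assms(5)
  proof (elim disjE conjE)
    assume T: "c \<le> T1 q a b"
    have c1: "c < 1" by (rule T1_imp_less_one[OF assms(1-4) T])
    have "B (Suc n) \<le> B n" for n
      using heine_coeff_diff[OF assms(1-4) c1, of n] heine_decrement_nonneg[OF q T q_pow, of n]
        mult_nonneg_nonneg[of _ "heine_decrement a b c q (q ^ n)"]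
      unfolding B_def by (smt (verit) mult_minus_left)
    then have dec: "decseq B" by (rule decseq_SucI)
    have B_pos: "0 \<le> B n" for n
      unfolding B_def using heine_coeff_pos[OF assms(1-4) c1, of n] q_pow[of "Suc n"] by simp
    obtain L where L: "B \<longlonglongrightarrow> L" "\<And>n. L \<le> B n"
      using decseq_convergent[OF dec, of 0] B_pos by auto
    moreover have "0 \<le> L" using L(1) B_pos by (intro LIMSEQ_le_const) auto
    moreover have "L \<le> 2 * (1 - q)" using L(2)[of 0] B0 q by simp
    ultimately show ?thesis using dec monoseq_iff by blast
  next
    assume c: "c = a * b" and ab: "0 < a" "0 < b"
      and le: "a * q + b * q + a + b - 2 * q \<le> 2 * a * b"
      and G: "q_gamma q (log q (a * b)) / (q_gamma q (log q a) * q_gamma q (log q b)) \<le> 2"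
    have c1: "c < 1" using c ab assms mult_strict_mono[of a 1 b 1] by simp
    have "B n \<le> B (Suc n)" for n
      using heine_coeff_diff[OF assms(1-4) c1, of n]
        heine_decrement_nonpos[OF q ab(1) assms(3) ab(2) assms(4) le q_pow, of n]
        mult_nonneg_nonpos[of _ "heine_decrement a b c q (q ^ n)"]
      unfolding B_def c by (smt (verit) mult_minus_left)
    then have inc: "incseq B" by (rule incseq_SucI)
    \<comment> \<open>This limit is \<open>1 - q\<close> times the quotient of \<open>q\<close>-gamma values.\<close>
    define L where "L = q_factorial_inf a q * q_factorial_inf b q /
      (q_factorial_inf c q * q_factorial_inf q q)"
    have "(\<lambda>n. q ^ Suc n) \<longlonglongrightarrow> 0" using q by (intro LIMSEQ_Suc LIMSEQ_realpow_zero) auto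
    then have "B \<longlonglongrightarrow> (1 - 0) * L"
      unfolding B_def heine_coeff_def L_def using assms c1
      by (intro tendsto_intros q_shifted_factorial_tendsto) (auto simp: q_factorial_inf_nonzero)
    then have lim: "B \<longlonglongrightarrow> L" by simp
    moreover have "B 0 \<le> L" by (rule incseq_le[OF inc lim])
    then have "0 \<le> L" using B0 q by simp
    moreover have "L \<le> 2 * (1 - q)"
    proof -
      have "L / (1 - q) \<le> 2"
        using G unfolding L_def c q_gamma_quotient[OF q ab(1) assms(3) ab(2) assms(4)] .
      then show ?thesis using q by (simp add: pos_divide_le_eq)
    qed
    ultimately show ?thesis using inc monoseq_iff by blast
  qed
  then obtain L where "monoseq B" "B \<longlonglongrightarrow> L" "0 \<le> L" "L \<le> 2 * (1 - q)" by blast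
  moreover have "heine_coeff a b c q 0 = 1"
    by (simp add: heine_coeff_def q_shifted_factorial_def)
  ultimately have "q_close_to_convex_with q (\<lambda>z. z / (1 - z))
      (\<lambda>z. z * heine_phi (of_real a) (of_real b) (of_real c) (of_real q) z)"
    unfolding heine_phi_of_real B_def[abs_def]
    by (intro q_close_to_convex_with_half_plane q)
  then show ?thesis by (auto simp: q_close_to_convex_functions_def)
qed

end
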